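(* Let $\alpha\in\mathbb{N}$ and let $C(\alpha)=(c_{i,j})_{i,j\ge1}$ be the infinite matrix over $\mathbb{Z}_2$ with $c_{i,j}=1$ if $i\le j<i+\alpha$ and $c_{i,j}=0$ otherwise. Let $X^{C(\alpha)}$ be the associated digital sequence. Then for all $p\in[1,\infty]$, $$L_p(X_N^{C(\alpha)})\ge \frac{2^{\alpha-1}}{2^{2\alpha}-1}\,\frac{\log N}{2\alpha\log 2}+O_\alpha(1)\quad\text{for infinitely many } N;$$ more precisely, this bound holds for all $N$ of the form $$N=\sum_{\ell=1}^r 2^{2\alpha(r-\ell)}=\frac{2^{2\alpha r}-1}{2^{2\alpha}-1},\qquad r\in\mathbb{N},$$ where $O_\alpha(1)$ denotes a quantity bounded in absolute value by a constant depending only on $\alpha$.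
   Context: $\mathbb{Z}_2=\{0,1\}$ is the field with two elements. Given an infinite matrix $C=(c_{i,j})_{i,j\ge1}$ over $\mathbb{Z}_2$ whose upper left $n\times n$ submatrices all have full rank, the digital sequence $X^C=(x_n)_{n\ge0}$ is defined as follows: for $n\in\mathbb{N}_0$ with binary expansion $n=n_0+n_12+n_22^2+\cdots$, let $\vec n=(n_0,n_1,\dots)^\top$, compute $C\vec n=(y_1^{(n)},y_2^{(n)},\dots)^\top$ over $\mathbb{Z}_2$, and set $x_n=\sum_{i\ge1}y_i^{(n)}2^{-i}$. For $N\in\mathbb{N}$, $X_N^C=\{x_0,\dots,x_{N-1}\}$. For a finite point set $\mathcal P=\{x_0,\dots,x_{N-1}\}\subset[0,1)$, the discrepancy function is $\Delta_{\mathcal P}(t)=\sum_{n=0}^{N-1}\mathbf 1_{[0,t)}(x_n)-Nt$, $t\in[0,1]$, and the $L_p$ discrepancy is $L_p(\mathcal P)=\|\Delta_{\mathcal P}\|_{L_p([0,1])}=\left(\int_0^1|\Delta_{\mathcal P}(t)|^p\,\mathrm dt\right)^{1/p}$ for $p<\infty$, and the supremum norm of $\Delta_{\mathcal P}$ for $p=\infty$. *)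

theory Defs
  imports "HOL-Analysis.Analysis" "HOL-Library.Z2"
begin

text \<open>
  The field with two elements is the type \<^typ>\<open>bit\<close>. Infinite matrices over it are functions
  \<^typ>\<open>nat \<Rightarrow> nat \<Rightarrow> bit\<close> read at indices \<open>i, j \<ge> 1\<close> only.
\<close>

definition binary_digit :: "nat \<Rightarrow> nat \<Rightarrow> bit" where
  "binary_digit n k = of_nat (n div 2 ^ k)"

text \<open>
  Column \<open>j\<close> meets digit \<open>j - 1\<close>. The infinite sum over \<open>j\<close> can be cut off at \<open>n\<close>, because
  \<open>n < 2 ^ n\<close> makes all later digits vanish.
\<close>

definition digital_output :: "(nat \<Rightarrow> nat \<Rightarrow> bit) \<Rightarrow> nat \<Rightarrow> nat \<Rightarrow> bit" where
  "digital_output C n i = (\<Sum>j = 1..n. C i j * binary_digit n (j - 1))"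

text \<open>Summation index \<open>k\<close> stands for the row \<open>i = k + 1\<close>.\<close>

definition digital_sequence :: "(nat \<Rightarrow> nat \<Rightarrow> bit) \<Rightarrow> nat \<Rightarrow> real" where
  "digital_sequence C n = (\<Sum>k. of_bool (digital_output C n (Suc k) = 1) / 2 ^ Suc k)"

text \<open>
  The point set is given by the first \<open>N\<close> terms of a sequence, counted with multiplicity.
\<close>

definition discrepancy :: "(nat \<Rightarrow> real) \<Rightarrow> nat \<Rightarrow> real \<Rightarrow> real" where
  "discrepancy x N t = (\<Sum>n<N. indicator {0..<t} (x n)) - real N * t"

definition Lp_discrepancy :: "ennreal \<Rightarrow> (nat \<Rightarrow> real) \<Rightarrow> nat \<Rightarrow> real" where
  "Lp_discrepancy p x N =
    (if p = \<infinity> then (SUP t\<in>{0..1}. \<bar>discrepancy x N t\<bar>)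
     else (LINT t:{0..1}|lborel. \<bar>discrepancy x N t\<bar> powr enn2real p) powr (1 / enn2real p))"

text \<open>
  For \<open>\<alpha> \<ge> 1\<close> this matrix is upper triangular with unit diagonal, so all its upper left
  \<open>n \<times> n\<close> submatrices have full rank and it generates a digital sequence.
\<close>

definition band_matrix :: "nat \<Rightarrow> nat \<Rightarrow> nat \<Rightarrow> bit" where
  "band_matrix \<alpha> i j = (if i \<le> j \<and> j < i + \<alpha> then 1 else 0)"

end

theory Submission
  imports Defs
begin

text \<open>
  The discrepancy function of \<open>x\<^sub>0, \<dots>, x\<^bsub>N-1\<^esub>\<close> has integral \<open>S(N) = \<Sum>\<^bsub>n<N\<^esub> (1/2 - x\<^sub>n)\<close> over
  \<open>[0,1]\<close>, and this bounds every \<open>L\<^sub>p\<close> norm with \<open>p \<ge> 1\<close> from below. For a band matrix, row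
  \<open>k + 1\<close> applied to \<open>n\<close> equals row \<open>1\<close> applied to \<open>n div 2 ^ k\<close>, whence
  \<open>x\<^sub>n = y(n) / 2 + x\<^bsub>n div 2\<^esub> / 2\<close> with \<open>y\<close> the output of row \<open>1\<close>. As \<open>y(2 n) \<noteq> y(2 n + 1)\<close>, it
  follows that \<open>S(2 n) = S(n)\<close>. With \<open>q = 2 ^ \<alpha>\<close>, the numbers \<open>N\<^sub>r\<close> of the theorem satisfy
  \<open>N\<^bsub>r+1\<^esub> = q\<^sup>2 N\<^sub>r + 1\<close>, so \<open>S\<close> grows by \<open>1/2 - x\<^sub>M\<close>, where \<open>M = q\<^sup>2 N\<^sub>r\<close>, from \<open>N\<^sub>r\<close> to \<open>N\<^bsub>r+1\<^esub>\<close>.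
  Since \<open>M\<close> has many trailing zeros, \<open>x\<^sub>M\<close> stays below \<open>1 / (2 (q + 1))\<close>.
\<close>

section \<open>Digital sequences of band matrices\<close>

definition first_row :: "nat \<Rightarrow> nat \<Rightarrow> bit" where
  "first_row \<alpha> n = (\<Sum>k<\<alpha>. binary_digit n k)"

lemma binary_digit_eq_0: "n \<le> k \<Longrightarrow> binary_digit n k = 0"
  by (metis binary_digit_def div_less leD leI less_exp order_less_le_trans of_nat_0)

lemma digital_output_band_matrix:
  "digital_output (band_matrix \<alpha>) n (Suc k) = first_row \<alpha> (n div 2 ^ k)"
proof -
  have "digital_output (band_matrix \<alpha>) n (Suc k)
      = (\<Sum>j<n. if j \<in> {k..<k + \<alpha>} then binary_digit n j else 0)"
    unfolding digital_output_def One_nat_def sum.atLeast1_atMost_eq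
    by (intro sum.cong) (auto simp: band_matrix_def)
  also have "\<dots> = (\<Sum>j\<in>{..<n} \<inter> {k..<k + \<alpha>}. binary_digit n j)"
    by (simp add: sum.inter_restrict)
  also have "\<dots> = (\<Sum>j\<in>{k..<k + \<alpha>}. binary_digit n j)"
    by (intro sum.mono_neutral_left ballI binary_digit_eq_0) auto
  also have "\<dots> = (\<Sum>i<\<alpha>. binary_digit n (k + i))"
    by (rule sum.reindex_bij_witness[of _ "\<lambda>i. k + i" "\<lambda>j. j - k"]) auto
  also have "\<dots> = first_row \<alpha> (n div 2 ^ k)"
    by (simp add: first_row_def binary_digit_def div_mult2_eq power_add)
  finally show ?thesis .
qed

lemma digital_sequence_band_matrix:
  "digital_sequence (band_matrix \<alpha>) n = (\<Sum>k. of_bool (first_row \<alpha> (n div 2 ^ k) = 1) / 2 ^ Suc k)"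
  by (simp add: digital_sequence_def digital_output_band_matrix)

lemma digit_series_bounds:
  fixes P :: "nat \<Rightarrow> bool"
  shows "summable (\<lambda>k. of_bool (P k) / 2 ^ Suc k :: real)"
    and "(\<Sum>k. of_bool (P k) / 2 ^ Suc k :: real) \<in> {0..1}"
proof -
  have geom: "(\<lambda>k. 1 / 2 ^ Suc k :: real) sums 1"
    using power_half_series by (simp add: power_one_over)
  show s: "summable (\<lambda>k. of_bool (P k) / 2 ^ Suc k :: real)"
    by (rule summable_comparison_test'[OF sums_summable[OF geom], of 0]) auto
  have "(\<Sum>k. of_bool (P k) / 2 ^ Suc k :: real) \<le> (\<Sum>k. 1 / 2 ^ Suc k)"
    by (rule suminf_le[OF _ s sums_summable[OF geom]]) auto
  then show "(\<Sum>k. of_bool (P k) / 2 ^ Suc k :: real) \<in> {0..1}"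
    using sums_unique[OF geom] suminf_nonneg[OF s] by auto
qed

lemma digital_sequence_in_unit_interval: "digital_sequence C n \<in> {0..1}"
  unfolding digital_sequence_def by (rule digit_series_bounds)

text \<open>These are the numbers N_r, whose \<open>r\<close> digits in base
  \<open>2 ^ (2 * \<alpha>)\<close> all equal 1. In Horner form, the passage to the next one is a
  shift by \<open>2 * \<alpha>\<close> binary places followed by adding one.\<close>

primrec horner_number :: "nat \<Rightarrow> nat \<Rightarrow> nat" where
  "horner_number \<alpha> 0 = 0"
| "horner_number \<alpha> (Suc r) = 2 ^ (2 * \<alpha>) * horner_number \<alpha> r + 1"

context
  fixes \<alpha> :: nat and x :: "nat \<Rightarrow> real"
  defines "x \<equiv> digital_sequence (band_matrix \<alpha>)"
begin

section \<open>Recursion of the sequence under halving of the index\<close>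

lemma band_sequence_rec: "x n = of_bool (first_row \<alpha> n = 1) / 2 + x (n div 2) / 2"
proof -
  have "x n = of_bool (first_row \<alpha> n = 1) / 2
      + (\<Sum>k. of_bool (first_row \<alpha> (n div 2 ^ Suc k) = 1) / 2 ^ Suc (Suc k))"
    unfolding x_def digital_sequence_band_matrix
    using suminf_split_head[OF digit_series_bounds(1), of "\<lambda>k. first_row \<alpha> (n div 2 ^ k) = 1"]
    by simp
  also have "(\<Sum>k. of_bool (first_row \<alpha> (n div 2 ^ Suc k) = 1) / 2 ^ Suc (Suc k)) = x (n div 2) / 2"
    unfolding x_def digital_sequence_band_matrix
    by (subst suminf_divide[OF digit_series_bounds(1), symmetric])
       (simp add: div_mult2_eq)
  finally show ?thesis .
qed

lemma band_sequence_le_half: "x n \<le> 1 / 2 + x (n div 2) / 2"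
  by (subst band_sequence_rec) simp

lemma first_row_dvd: "2 ^ \<alpha> dvd n \<Longrightarrow> first_row \<alpha> n = 0"
proof -
  assume "2 ^ \<alpha> dvd n"
  have "binary_digit n k = 0" if k: "k < \<alpha>" for k
  proof -
    have "2 ^ Suc k dvd n"
      using \<open>2 ^ \<alpha> dvd n\<close> k by (meson Suc_leI dvd_trans le_imp_power_dvd)
    then obtain m where "n = 2 ^ Suc k * m" ..
    then have "n div 2 ^ k = 2 * m"
      by simp
    then show ?thesis
      by (simp add: binary_digit_def)
  qed
  then show ?thesis
    by (simp add: first_row_def)
qed

lemma band_sequence_dvd: "2 ^ \<alpha> dvd n \<Longrightarrow> x n = x (n div 2) / 2"
  by (subst band_sequence_rec) (simp add: first_row_dvd)

text \<open>Each doubling prepends a zero to the output, because row 1 reads only zeros. The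
  hypothesis concerns \<open>2 * m\<close>, the first index at which row 1 has to vanish.\<close>

lemma band_sequence_shift:
  assumes "2 ^ \<alpha> dvd 2 * m"
  shows "x (2 ^ j * m) = x m / 2 ^ j"
proof (induction j)
  case (Suc j)
  have "2 * m dvd 2 ^ Suc j * m"
    by simp
  then have "x (2 ^ Suc j * m) = x (2 ^ j * m) / 2"
    using assms band_sequence_dvd[of "2 ^ Suc j * m"] by (simp add: dvd_trans mult.assoc)
  then show ?case
    by (simp add: Suc)
qed simp

text \<open>Substitute for exact halving when \<open>m\<close> is arbitrary: a doubling prepends one
  output digit, and even if that digit is 1, the distance to 1 is only halved.\<close>

lemma one_minus_band_sequence_shift: "1 - x (2 ^ j * m) \<ge> (1 - x m) / 2 ^ j"
proof (induction j)
  case (Suc j)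
  have "(1 - x m) / 2 ^ Suc j = (1 - x m) / 2 ^ j / 2"
    by simp
  also have "\<dots> \<le> (1 - x (2 ^ j * m)) / 2"
    using Suc by (intro divide_right_mono) auto
  also have "\<dots> \<le> 1 - x (2 ^ Suc j * m)"
    using band_sequence_le_half[of "2 ^ Suc j * m"] by (simp add: mult.assoc diff_divide_distrib)
  finally show ?case .
qed simp

section \<open>The sum \<open>S\<close> under doubling, and its growth along the numbers N_r\<close>

lemma first_row_double:
  assumes "\<alpha> \<ge> 1"
  shows "first_row \<alpha> (2 * n + 1) = first_row \<alpha> (2 * n) + 1"
proof -
  obtain \<beta> where "\<alpha> = Suc \<beta>"
    using assms by (cases \<alpha>) auto
  moreover have "(2 * n + 1) div 2 ^ Suc k = 2 * n div 2 ^ Suc k" for k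
    by (simp add: div_mult2_eq)
  ultimately show ?thesis
    unfolding first_row_def binary_digit_def
    by (simp add: sum.lessThan_Suc_shift del: power_Suc sum.lessThan_Suc)
qed

text \<open>Both points share the tail \<open>x n / 2\<close>, and row 1 outputs 1 for exactly one
  of them, as the two indices differ only in digit 0.\<close>

lemma band_sequence_pair:
  assumes "\<alpha> \<ge> 1"
  shows "x (2 * n) + x (2 * n + 1) = 1 / 2 + x n"
proof -
  have "x (2 * n) = of_bool (first_row \<alpha> (2 * n) = 1) / 2 + x n / 2"
    by (subst band_sequence_rec) simp
  moreover have "x (2 * n + 1) = of_bool (first_row \<alpha> (2 * n + 1) = 1) / 2 + x n / 2"
    by (subst band_sequence_rec) simp
  ultimately show ?thesis
    using first_row_double[OF assms, of n] by (cases "first_row \<alpha> (2 * n)") auto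
qed

lemma sum_band_sequence_double:
  assumes "\<alpha> \<ge> 1"
  shows "(\<Sum>n<2 * N. 1 / 2 - x n) = (\<Sum>n<N. 1 / 2 - x n)"
proof (induction N)
  case (Suc N)
  then show ?case
    using band_sequence_pair[OF assms, of N] by simp
qed simp

lemma sum_band_sequence_shift:
  assumes "\<alpha> \<ge> 1"
  shows "(\<Sum>n<2 ^ j * N. 1 / 2 - x n) = (\<Sum>n<N. 1 / 2 - x n)"
  by (induction j) (simp_all add: mult.assoc sum_band_sequence_double[OF assms])

text \<open>With q = \<open>2 ^ \<alpha>\<close>, the bound is the fixed point of the map b -> (1 -
  (1/2 - b) / (q/2)) / (2 q), by which the estimate passes from one \<open>r\<close> to the
  next.\<close>

lemma band_sequence_horner_le:
  assumes "\<alpha> \<ge> 1"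
  shows "x (2 ^ (2 * \<alpha>) * horner_number \<alpha> r) \<le> 1 / (2 * (2 ^ \<alpha> + 1))"
proof (induction r)
  case 0
  have "x 0 = x 0 / 2"
    using band_sequence_dvd[of 0] by simp
  then show ?case
    by simp
next
  case (Suc r)
  define q :: real where "q = 2 ^ \<alpha>"
  have q: "q \<ge> 2"
    unfolding q_def using assms self_le_power[of "2::real" \<alpha>] by simp
  define M where "M = 2 ^ (2 * \<alpha>) * horner_number \<alpha> r"
  obtain \<beta> where \<beta>: "\<alpha> = Suc \<beta>"
    using assms by (cases \<alpha>) auto
  have q\<beta>: "q = 2 * 2 ^ \<beta>"
    by (simp add: q_def \<beta>)
  have dvd: "2 ^ \<alpha> dvd M"
    unfolding M_def by (intro dvd_mult2 le_imp_power_dvd) simp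
  have "even M"
    using dvd \<beta> by (metis dvd_power dvd_trans zero_less_Suc)
  then have "(M + 1) div 2 = M div 2"
    by presburger
  \<comment> \<open>At \<open>M + 1\<close> row 1 may output 1, but the remaining part
    \<open>x (M div 2) / 2\<close> equals \<open>x M\<close>.\<close>
  then have succ: "x (M + 1) \<le> 1 / 2 + x M"
    using band_sequence_le_half[of "M + 1"] band_sequence_dvd[OF dvd] by simp
  \<comment> \<open>The shift is split. During the first \<open>\<beta>\<close> doublings of
    \<open>M + 1\<close>, row 1 still reads its last digit 1, so only the distance to 1 is
    controlled; the other \<open>\<alpha> + 1\<close> doublings halve the point exactly.\<close>
  have "(2::nat) ^ (2 * \<alpha>) = 2 ^ (\<alpha> + 1) * 2 ^ \<beta>"
    unfolding power_add[symmetric] by (simp add: \<beta>)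
  then have "2 ^ (2 * \<alpha>) * horner_number \<alpha> (Suc r) = 2 ^ (\<alpha> + 1) * (2 ^ \<beta> * (M + 1))"
    by (simp only: horner_number.simps M_def mult.assoc)
  also have "x \<dots> = x (2 ^ \<beta> * (M + 1)) / 2 ^ (\<alpha> + 1)"
    by (rule band_sequence_shift) (simp add: \<beta>)
  also have "\<dots> \<le> (1 - (1 - x (M + 1)) / 2 ^ \<beta>) / 2 ^ (\<alpha> + 1)"
    using one_minus_band_sequence_shift[of "M + 1" \<beta>] by (intro divide_right_mono) auto
  also have "\<dots> \<le> (1 - (1 / 2 - 1 / (2 * (q + 1))) / 2 ^ \<beta>) / 2 ^ (\<alpha> + 1)"
    using succ Suc by (intro divide_right_mono diff_left_mono) (auto simp: M_def q_def)
  also have "\<dots> = (1 - (1 / 2 - 1 / (2 * (q + 1))) / (q / 2)) / (2 * q)"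
    by (simp add: q\<beta> \<beta>)
  also have "\<dots> = 1 / (2 * (q + 1))"
    using q by (simp add: divide_simps)
  finally show ?case
    by (simp add: q_def)
qed

lemma sum_band_sequence_horner_ge:
  assumes "\<alpha> \<ge> 1"
  shows "(\<Sum>n<horner_number \<alpha> r. 1 / 2 - x n) \<ge> real r * (2 ^ (\<alpha> - 1) / (2 ^ (2 * \<alpha>) - 1))"
proof (induction r)
  case (Suc r)
  define q :: real where "q = 2 ^ \<alpha>"
  have q: "q \<ge> 2"
    unfolding q_def using assms self_le_power[of "2::real" \<alpha>] by simp
  have half: "2 ^ (\<alpha> - 1) = q / 2"
    using assms by (simp add: q_def power_diff)
  have square: "2 ^ (2 * \<alpha>) = q\<^sup>2"
    by (simp add: q_def power_mult mult.commute)
  \<comment> \<open>The lower bound q / (2 (q + 1)) for the gain per step is q - 1 times the claimed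
    constant, and q - 1 \<ge> 1.\<close>
  have "0 \<le> (q - 2) * (q + 1)"
    using q by simp
  then have "q + 1 \<le> q\<^sup>2 - 1"
    by (simp add: power2_eq_square algebra_simps)
  then have "q / 2 / (q\<^sup>2 - 1) \<le> q / 2 / (q + 1)"
    using q by (intro divide_left_mono) auto
  also have "\<dots> = 1 / 2 - 1 / (2 * (q + 1))"
    using q by (simp add: field_simps)
  also have "\<dots> \<le> 1 / 2 - x (2 ^ (2 * \<alpha>) * horner_number \<alpha> r)"
    using band_sequence_horner_le[OF assms, of r] by (simp add: q_def)
  finally have "2 ^ (\<alpha> - 1) / (2 ^ (2 * \<alpha>) - 1)
      \<le> 1 / 2 - x (2 ^ (2 * \<alpha>) * horner_number \<alpha> r)"
    by (simp only: half square)
  moreover have "(\<Sum>n<horner_number \<alpha> (Suc r). 1 / 2 - x n)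
      = (\<Sum>n<horner_number \<alpha> r. 1 / 2 - x n) + (1 / 2 - x (2 ^ (2 * \<alpha>) * horner_number \<alpha> r))"
    using sum_band_sequence_shift[OF assms, of "2 * \<alpha>" "horner_number \<alpha> r"] by simp
  moreover have "real (Suc r) * (2 ^ (\<alpha> - 1) / (2 ^ (2 * \<alpha>) - 1))
      = real r * (2 ^ (\<alpha> - 1) / (2 ^ (2 * \<alpha>) - 1)) + 2 ^ (\<alpha> - 1) / (2 ^ (2 * \<alpha>) - (1 :: real))"
    by (simp only: of_nat_Suc distrib_right mult_1_left add.commute)
  ultimately show ?case
    using Suc by linarith
qed simp

end

section \<open>Closed form and logarithm of the numbers N_r\<close>

lemma horner_number_eq_sum: "(\<Sum>l = 1..r. 2 ^ (2 * \<alpha> * (r - l))) = horner_number \<alpha> r"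
proof -
  have "(\<Sum>l = 1..r. 2 ^ (2 * \<alpha> * (r - l))) = (\<Sum>i<r. 2 ^ (2 * \<alpha> * i) :: nat)"
    unfolding One_nat_def sum.atLeast1_atMost_eq
    using sum.nat_diff_reindex[of "\<lambda>i. 2 ^ (2 * \<alpha> * i)" r] .
  also have "\<dots> = horner_number \<alpha> r"
  proof (induction r)
    case (Suc r)
    have "(\<Sum>i<Suc r. 2 ^ (2 * \<alpha> * i) :: nat) = 1 + (\<Sum>i<r. 2 ^ (2 * \<alpha>) * 2 ^ (2 * \<alpha> * i))"
      by (simp add: sum.lessThan_Suc_shift power_add del: sum.lessThan_Suc)
    then show ?case
      by (simp add: Suc flip: sum_distrib_left)
  qed simp
  finally show ?thesis .
qed

lemma horner_number_closed_form:
  assumes "\<alpha> \<ge> 1"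
  shows "real (horner_number \<alpha> r) = (2 ^ (2 * \<alpha> * r) - 1) / (2 ^ (2 * \<alpha>) - 1)"
proof -
  have "(2::real) ^ (2 * \<alpha>) > 1"
    using assms by (intro one_less_power) auto
  then show ?thesis
    by (induction r) (simp_all add: field_simps power_add)
qed

text \<open>The crude estimate N_r \<le> \<open>2 ^ (2 * \<alpha> * r)\<close> errs in the harmless
  direction: in the lower bound, \<open>r\<close> is replaced by something no larger, so no error
  term arises.\<close>

lemma ln_horner_number_le:
  assumes "\<alpha> \<ge> 1" and "r \<ge> 1"
  shows "ln (real (horner_number \<alpha> r)) / (2 * real \<alpha> * ln 2) \<le> real r"
proof -
  have "(2::real) ^ 1 \<le> 2 ^ (2 * \<alpha>)"
    using assms by (intro power_increasing) auto
  then have "real (horner_number \<alpha> r) \<le> (2 ^ (2 * \<alpha> * r) - 1) / 1"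
    unfolding horner_number_closed_form[OF assms(1)] by (intro divide_left_mono) auto
  also have "\<dots> \<le> 2 ^ (2 * \<alpha> * r)"
    by simp
  finally have "real (horner_number \<alpha> r) \<le> 2 ^ (2 * \<alpha> * r)" .
  moreover have "horner_number \<alpha> r > 0"
    using assms(2) by (cases r) auto
  ultimately have "ln (real (horner_number \<alpha> r)) \<le> ln (2 ^ (2 * \<alpha> * r))"
    by (subst ln_le_cancel_iff) auto
  also have "\<dots> = real r * (2 * real \<alpha> * ln 2)"
    by (simp add: ln_realpow)
  finally show ?thesis
    using assms by (simp add: pos_divide_le_eq)
qed

lemma strict_mono_horner_number: "strict_mono (horner_number \<alpha>)"
  unfolding strict_mono_Suc_iff by (simp add: less_Suc_eq_le)

section \<open>The mean of the discrepancy function\<close>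

lemma discrepancy_measurable [measurable]: "discrepancy x N \<in> borel_measurable borel"
proof -
  \<comment> \<open>The variable \<open>t\<close> moves from the set of the indicator into an
    inequality, which makes measurability in \<open>t\<close> visible.\<close>
  have "discrepancy x N = (\<lambda>t. (\<Sum>n<N. of_bool (0 \<le> x n \<and> x n < t)) - real N * t)"
    by (auto simp: discrepancy_def fun_eq_iff indicator_def intro!: sum.cong)
  then show ?thesis
    by simp
qed

lemma abs_discrepancy_le:
  assumes "t \<in> {0..1}"
  shows "\<bar>discrepancy x N t\<bar> \<le> real N"
proof -
  have "(\<Sum>n<N. indicator {0..<t} (x n) :: real) \<le> (\<Sum>n<N. 1)"
    by (intro sum_mono) (simp add: indicator_def)
  moreover have "0 \<le> (\<Sum>n<N. indicator {0..<t} (x n) :: real)"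
    by (intro sum_nonneg) simp
  moreover have "real N * t \<le> real N" "0 \<le> real N * t"
    using assms by (auto simp: mult_left_le)
  ultimately show ?thesis
    by (simp add: discrepancy_def)
qed

lemma set_integrable_bounded_unit_interval:
  fixes f :: "real \<Rightarrow> real"
  assumes "f \<in> borel_measurable borel" and "\<And>t. t \<in> {0..1} \<Longrightarrow> \<bar>f t\<bar> \<le> B"
  shows "set_integrable lborel {0..1} f"
  unfolding set_integrable_def
  by (rule integrableI_bounded_set_indicator[where B = B]) (use assms in auto)

text \<open>By linearity: a point y contributes the integral of the indicator of (y, 1], which is 1
  - y, minus the integral of t, which is 1/2.\<close>

lemma set_integral_discrepancy:
  assumes x: "\<And>n. x n \<in> {0..1}"
  shows "(LINT t:{0..1}|lborel. discrepancy x N t) = (\<Sum>n<N. 1 / 2 - x n)"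
proof (induction N)
  case 0
  then show ?case
    by (simp add: discrepancy_def set_lebesgue_integral_def)
next
  case (Suc N)
  define y where "y = x N"
  have y: "0 \<le> y" "y \<le> 1"
    using x[of N] by (auto simp: y_def)
  have int: "set_integrable lborel {0..1} (\<lambda>t. indicator {y<..} t :: real)"
    by (rule set_integrable_bounded_unit_interval[where B = 1]) (auto simp: indicator_def)
  have int_id: "set_integrable lborel {0..1} (\<lambda>t. t :: real)"
    by (rule set_integrable_bounded_unit_interval[where B = 1]) auto
  have int_d: "set_integrable lborel {0..1} (discrepancy x N)"
    by (rule set_integrable_bounded_unit_interval[where B = N]) (auto intro: abs_discrepancy_le)
  have "discrepancy x (Suc N) t = discrepancy x N t + (indicator {y<..} t - t)" for t
    using y by (auto simp: discrepancy_def y_def indicator_def algebra_simps)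
  then have "(LINT t:{0..1}|lborel. discrepancy x (Suc N) t)
      = (LINT t:{0..1}|lborel. discrepancy x N t)
        + ((LINT t:{0..1}|lborel. indicator {y<..} t) - (LINT t:{0..1}|lborel. t))"
    using int int_id int_d by simp
  also have "(LINT t:{0..1}|lborel. indicator {y<..} t) = (1 - y :: real)"
  proof -
    have "(LINT t:{0..1}|lborel. indicator {y<..} t) = (LINT t|lborel. indicator {y<..1} t :: real)"
      unfolding set_lebesgue_integral_def
      by (rule Bochner_Integration.integral_cong) (use y in \<open>auto simp: indicator_def\<close>)
    then show ?thesis
      using y by simp
  qed
  also have "(LINT t:{0..1}|lborel. t) = (1 / 2 :: real)"
    using integral_power[of 0 1 1] by (simp add: set_lebesgue_integral_def mult.commute)
  finally show ?case
    by (simp add: Suc y_def)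
qed

section \<open>Comparison of L_p norms with the mean\<close>

lemma powr_ge_tangent:
  fixes a M p :: real
  assumes "a \<ge> 0" "M > 0" "p \<ge> 1"
  shows "M powr p + p * M powr (p - 1) * (a - M) \<le> a powr p"
proof (cases "a = 0")
  \<comment> \<open>Zero lies outside the open half-line on which the tangent argument runs; here
    the claim reduces to \<open>M powr p \<le> p * M powr p\<close>.\<close>
  case True
  have "M powr p = M powr (p - 1) * M"
    using assms(2) by (simp add: powr_diff)
  moreover have "1 * (M powr (p - 1) * M) \<le> p * (M powr (p - 1) * M)"
    using assms by (intro mult_right_mono) auto
  ultimately show ?thesis
    using True by (simp add: mult.assoc)
next
  case False
  have "a powr p - M powr p \<ge> p * M powr (p - 1) * (a - M)"
  proof (rule convex_on_imp_above_tangent[where A = "{0<..}"])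
    show "((\<lambda>x. x powr p) has_real_derivative p * M powr (p - 1)) (at M within {0<..})"
      using assms(2) by (auto intro!: derivative_eq_intros)
  qed (use assms False in \<open>auto simp: powr_convex interior_open\<close>)
  then show ?thesis
    by simp
qed

text \<open>Jensen's inequality on the unit interval, by integrating the tangent bound at
  \<open>M\<close>. For p = \<infinity> the supremum dominates the integrand on an interval of
  length 1.\<close>

lemma Lp_discrepancy_ge_mean:
  assumes p: "p \<ge> 1" and M: "M > 0" "M \<le> (LINT t:{0..1}|lborel. discrepancy x N t)"
  shows "M \<le> Lp_discrepancy p x N"
proof (cases "p = \<infinity>")
  case True
  have bdd: "bdd_above ((\<lambda>t. \<bar>discrepancy x N t\<bar>) ` {0..1})"
    using abs_discrepancy_le by (intro bdd_aboveI2) auto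
  have "(LINT t:{0..1}|lborel. discrepancy x N t)
      \<le> (LINT s:{0..1::real}|lborel. (SUP t\<in>{0..1}. \<bar>discrepancy x N t\<bar>))"
  proof (rule set_integral_mono)
    fix t :: real
    assume "t \<in> {0..1}"
    then have "\<bar>discrepancy x N t\<bar> \<le> (SUP t\<in>{0..1}. \<bar>discrepancy x N t\<bar>)"
      by (rule cSUP_upper[OF _ bdd])
    then show "discrepancy x N t \<le> (SUP t\<in>{0..1}. \<bar>discrepancy x N t\<bar>)"
      by linarith
  qed (auto intro!: set_integrable_bounded_unit_interval abs_discrepancy_le)
  also have "\<dots> = Lp_discrepancy p x N"
    using True by (simp add: Lp_discrepancy_def set_integral_const)
  finally show ?thesis
    using M(2) by simp
next
  case False
  define P where "P = enn2real p"
  have P: "P \<ge> 1"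
    using p False enn2real_mono[of 1 p] by (simp add: P_def top.not_eq_extremum)
  let ?D = "discrepancy x N" and ?c = "P * M powr (P - 1)"
  have c: "?c \<ge> 0"
    using P by simp
  have int: "set_integrable lborel {0..1} ?D"
    by (rule set_integrable_bounded_unit_interval[where B = N]) (auto intro: abs_discrepancy_le)
  have const: "set_integrable lborel {0..1} (\<lambda>t::real. b :: real)" for b
    by (rule set_integrable_bounded_unit_interval[where B = "\<bar>b\<bar>"]) auto
  \<comment> \<open>A lower bound \<open>M\<close> for the mean suffices: the slope
    \<open>?c\<close> is nonnegative, so the correction has the right sign.\<close>
  have "M powr P \<le> M powr P + ?c * ((LINT t:{0..1}|lborel. ?D t) - M)"
    using M c by simp
  also have "\<dots> = (LINT t:{0..1}|lborel. M powr P + ?c * (?D t - M))"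
    using int const by (simp add: set_integral_const)
  also have "\<dots> \<le> (LINT t:{0..1}|lborel. \<bar>?D t\<bar> powr P)"
  proof (rule set_integral_mono)
    show "set_integrable lborel {0..1} (\<lambda>t. \<bar>?D t\<bar> powr P)"
    proof (rule set_integrable_bounded_unit_interval)
      show "\<bar>\<bar>?D t\<bar> powr P\<bar> \<le> N powr P" if "t \<in> {0..1}" for t
        using abs_discrepancy_le[OF that] P by (simp add: powr_mono2)
    qed simp
    show "M powr P + ?c * (?D t - M) \<le> \<bar>?D t\<bar> powr P" for t
    proof -
      have "?c * (?D t - M) \<le> ?c * (\<bar>?D t\<bar> - M)"
        using c by (intro mult_left_mono) auto
      then show ?thesis
        using powr_ge_tangent[of "\<bar>?D t\<bar>" M P] M(1) P by linarith
    qed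
  qed (use int const in auto)
  finally have "(M powr P) powr (1 / P) \<le> (LINT t:{0..1}|lborel. \<bar>?D t\<bar> powr P) powr (1 / P)"
    using P by (intro powr_mono2) auto
  then show ?thesis
    using P M(1) False by (simp add: Lp_discrepancy_def P_def powr_powr)
qed

section \<open>The lower bound along the numbers N_r\<close>

lemma Lp_discrepancy_band_matrix_ge:
  assumes "\<alpha> \<ge> 1" and "r \<ge> 1" and "p \<ge> 1"
  shows "2 ^ (\<alpha> - 1) / (2 ^ (2 * \<alpha>) - 1) * (ln (real (horner_number \<alpha> r)) / (2 * real \<alpha> * ln 2))
    \<le> Lp_discrepancy p (digital_sequence (band_matrix \<alpha>)) (horner_number \<alpha> r)"
proof -
  let ?c = "2 ^ (\<alpha> - 1) / (2 ^ (2 * \<alpha>) - 1) :: real"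
  have "(1::real) < 2 ^ (2 * \<alpha>)"
    using assms by (intro one_less_power) auto
  then have c: "?c > 0"
    by simp
  then have "?c * (ln (real (horner_number \<alpha> r)) / (2 * real \<alpha> * ln 2)) \<le> ?c * real r"
    using ln_horner_number_le[OF assms(1,2)] by (intro mult_left_mono) auto
  also have "\<dots> \<le> Lp_discrepancy p (digital_sequence (band_matrix \<alpha>)) (horner_number \<alpha> r)"
  proof (rule Lp_discrepancy_ge_mean[OF assms(3)])
    show "?c * real r > 0"
      using c assms(2) by (intro mult_pos_pos) auto
    show "?c * real r \<le> (LINT t:{0..1}|lborel.
        discrepancy (digital_sequence (band_matrix \<alpha>)) (horner_number \<alpha> r) t)"
      using sum_band_sequence_horner_ge[OF assms(1), of r]
      by (simp only: set_integral_discrepancy[OF digital_sequence_in_unit_interval] mult.commute)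
  qed
  finally show ?thesis .
qed

theorem theorem1:
  fixes \<alpha> :: nat
  assumes "\<alpha> \<ge> 1"
  shows "\<exists>K::real. \<forall>p::ennreal. p \<ge> 1 \<longrightarrow>
    infinite {N::nat. \<exists>E::real. \<bar>E\<bar> \<le> K \<and>
      Lp_discrepancy p (digital_sequence (band_matrix \<alpha>)) N
        \<ge> 2 ^ (\<alpha> - 1) / (2 ^ (2 * \<alpha>) - 1) * (ln (real N) / (2 * real \<alpha> * ln 2)) + E} \<and>
    (\<forall>r\<ge>1. \<forall>N::nat. N = (\<Sum>l = 1..r. 2 ^ (2 * \<alpha> * (r - l))) \<longrightarrow>
      real N = (2 ^ (2 * \<alpha> * r) - 1) / (2 ^ (2 * \<alpha>) - 1) \<and>
      (\<exists>E::real. \<bar>E\<bar> \<le> K \<and>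
        Lp_discrepancy p (digital_sequence (band_matrix \<alpha>)) N
          \<ge> 2 ^ (\<alpha> - 1) / (2 ^ (2 * \<alpha>) - 1) * (ln (real N) / (2 * real \<alpha> * ln 2)) + E))"
\<comment> \<open>The bound holds with error \<open>E = 0\<close> for every \<open>p\<close>, so
  \<open>K = 0\<close> serves as the constant.\<close>
proof (rule exI[of _ 0], intro allI impI conjI)
  fix p :: ennreal
  assume p: "p \<ge> 1"
  let ?bound = "\<lambda>N. \<exists>E::real. \<bar>E\<bar> \<le> 0 \<and>
    Lp_discrepancy p (digital_sequence (band_matrix \<alpha>)) N
      \<ge> 2 ^ (\<alpha> - 1) / (2 ^ (2 * \<alpha>) - 1) * (ln (real N) / (2 * real \<alpha> * ln 2)) + E"
  have bound: "?bound (horner_number \<alpha> r)" if "r \<ge> 1" for r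
    using Lp_discrepancy_band_matrix_ge[OF assms that p] by (intro exI[of _ 0]) simp
  have "infinite (horner_number \<alpha> ` {1..})"
    using strict_mono_imp_inj_on[OF strict_mono_horner_number] finite_imageD infinite_Ici by blast
  then show "infinite {N. ?bound N}"
    by (rule infinite_super[rotated]) (use bound in auto)
  fix r N :: nat
  assume r: "r \<ge> 1" and "N = (\<Sum>l = 1..r. 2 ^ (2 * \<alpha> * (r - l)))"
  then have N: "N = horner_number \<alpha> r"
    by (simp only: horner_number_eq_sum)
  show "real N = (2 ^ (2 * \<alpha> * r) - 1) / (2 ^ (2 * \<alpha>) - 1)"
    unfolding N by (rule horner_number_closed_form[OF assms])
  show "?bound N"
    unfolding N by (rule bound[OF r])
qed

end
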